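(* Let $S=\Bbbk[x_1,\dots,x_n]$ be a polynomial ring over a field $\Bbbk$, and let $I$ and $J$ be two homogeneous ideals of $S$ with $\mathrm{Gens}(J)\cap\mathrm{Gens}(I)=\emptyset$. Then $I\cap J=IJ$.
   Context: $S$ has the standard grading ($\deg x_i=1$). For a homogeneous ideal $I$, $\mathrm{Gens}(I)$ denotes the set of variables $x_i$ that occur in the elements of the (chosen) minimal homogeneous generating set of $I$. Thus the hypothesis says that $I$ and $J$ have minimal homogeneous generating sets whose elements involve disjoint sets of variables. *)

theory Defs
  imports "HOL-Library.Poly_Mapping" "HOL-Algebra.Ideal_Product"
begin

text \<open>
  A monomial is a finitely supported exponent vector, and a polynomial a finitely supported
  function from monomials to coefficients; multiplication is the library's convolution product.
\<close>

type_synonym monom = "nat \<Rightarrow>\<^sub>0 nat"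
type_synonym 'k mpoly = "monom \<Rightarrow>\<^sub>0 'k"

definition vars :: "'k::zero mpoly \<Rightarrow> nat set" where
  "vars p = (\<Union>m\<in>Poly_Mapping.keys p. Poly_Mapping.keys m)"

definition mpoly_ring :: "nat \<Rightarrow> 'k::comm_ring_1 mpoly ring" where
  "mpoly_ring n =
     \<lparr>carrier = {p. vars p \<subseteq> {1..n}}, monoid.mult = (*), one = 1, zero = 0, add = (+)\<rparr>"

definition monom_degree :: "monom \<Rightarrow> nat" where
  "monom_degree m = (\<Sum>i\<in>Poly_Mapping.keys m. Poly_Mapping.lookup m i)"

text \<open>In particular, the zero polynomial is homogeneous (of every degree).\<close>

definition homogeneous :: "'k::zero mpoly \<Rightarrow> bool" where
  "homogeneous p \<longleftrightarrow> (\<exists>d. \<forall>m\<in>Poly_Mapping.keys p. monom_degree m = d)"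

definition homogeneous_ideal :: "nat \<Rightarrow> 'k::comm_ring_1 mpoly set \<Rightarrow> bool" where
  "homogeneous_ideal n I \<longleftrightarrow> ideal I (mpoly_ring n) \<and>
     (\<exists>G \<subseteq> carrier (mpoly_ring n). (\<forall>g\<in>G. homogeneous g) \<and> I = Idl\<^bsub>mpoly_ring n\<^esub> G)"

text \<open>
  Minimality is irredundancy: no proper subset generates the ideal. Finiteness of such a set
  need not be required, because the polynomial ring over a field is Noetherian.
\<close>

definition minimal_homogeneous_gens ::
    "nat \<Rightarrow> 'k::comm_ring_1 mpoly set \<Rightarrow> 'k mpoly set \<Rightarrow> bool" where
  "minimal_homogeneous_gens n G I \<longleftrightarrow>
     G \<subseteq> carrier (mpoly_ring n) \<and> (\<forall>g\<in>G. homogeneous g) \<and>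
     I = Idl\<^bsub>mpoly_ring n\<^esub> G \<and> (\<forall>G'. G' \<subset> G \<longrightarrow> Idl\<^bsub>mpoly_ring n\<^esub> G' \<noteq> I)"

text \<open>
  The variables occurring in a generating set. They depend on the chosen set and not only on the
  ideal it generates, hence the argument is the generating set.
\<close>

definition Gens :: "'k::zero mpoly set \<Rightarrow> nat set" where
  "Gens G = (\<Union>g\<in>G. vars g)"

lemma vars_zero [simp]: "vars 0 = {}"
  by (simp add: vars_def)

lemma vars_one [simp]: "vars (1 :: 'k::comm_ring_1 mpoly) = {}"
  by (simp add: vars_def)

lemma vars_uminus [simp]: "vars (- p) = vars (p :: 'k::comm_ring_1 mpoly)"
  by (simp add: vars_def)

lemma vars_add: "vars (p + q) \<subseteq> vars p \<union> vars (q :: 'k::comm_ring_1 mpoly)"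
  unfolding vars_def using Poly_Mapping.keys_add[of p q] by blast

lemma vars_mult: "vars (p * q) \<subseteq> vars p \<union> vars (q :: 'k::comm_ring_1 mpoly)"
proof
  fix i assume "i \<in> vars (p * q)"
  then obtain m where m: "m \<in> Poly_Mapping.keys (p * q)" "i \<in> Poly_Mapping.keys m"
    by (auto simp: vars_def)
  then obtain a b where "a \<in> Poly_Mapping.keys p" "b \<in> Poly_Mapping.keys q" "m = a + b"
    using Poly_Mapping.keys_mult[of p q] by blast
  then show "i \<in> vars p \<union> vars q"
    using m(2) Poly_Mapping.keys_add[of a b] by (auto simp: vars_def)
qed

lemma cring_mpoly_ring: "cring (mpoly_ring n :: 'k::comm_ring_1 mpoly ring)"
proof (rule cringI)
  show "abelian_group (mpoly_ring n :: 'k mpoly ring)"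
  proof (rule abelian_groupI)
    fix p :: "'k mpoly" assume "p \<in> carrier (mpoly_ring n)"
    then show "\<exists>q\<in>carrier (mpoly_ring n). q \<oplus>\<^bsub>mpoly_ring n\<^esub> p = \<zero>\<^bsub>mpoly_ring n\<^esub>"
      by (intro bexI[of _ "- p"]) (auto simp: mpoly_ring_def)
  qed (use vars_add in \<open>fastforce simp: mpoly_ring_def algebra_simps\<close>)+
  show "comm_monoid (mpoly_ring n :: 'k mpoly ring)"
    by (rule comm_monoidI) (use vars_mult in \<open>fastforce simp: mpoly_ring_def algebra_simps\<close>)+
qed (simp add: mpoly_ring_def algebra_simps)

end

theory Submission
  imports Defs "HOL.Vector_Spaces"
begin

text \<open>
  Write \<open>X\<close> for the set of variables of the generators of \<open>I\<close>, so that the generators of \<open>J\<close> use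
  only variables outside \<open>X\<close>. As a vector space, the polynomial ring is the tensor product of
  \<open>k[X]\<close> and \<open>k[-X]\<close>. Over a field there is a linear projection \<open>\<phi>\<close> of the whole polynomial ring
  onto \<open>I\<close> (\<open>linear_projection_onto\<close>), and there is a linear map \<open>\<Phi>\<close> with \<open>\<Phi> (p * q) = \<phi> p * q\<close>
  for all \<open>p\<close> in \<open>k[X]\<close> and \<open>q\<close> in \<open>k[-X]\<close> (\<open>separated_extension_mult\<close>). Let \<open>x\<^sup>u\<close> and \<open>x\<^sup>v\<close>
  be monomials in the variables in \<open>X\<close> and outside \<open>X\<close>, respectively.

  For a generator \<open>g\<close> of \<open>I\<close> one has \<open>\<Phi> (x\<^sup>u x\<^sup>v g) = \<phi> (x\<^sup>u g) x\<^sup>v = x\<^sup>u x\<^sup>v g\<close>, because \<open>x\<^sup>u g\<close> is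
  in \<open>I\<close>; hence \<open>\<Phi>\<close> fixes every element of \<open>I\<close>. For a generator \<open>h\<close> of \<open>J\<close> one has
  \<open>\<Phi> (x\<^sup>u x\<^sup>v h) = \<phi> (x\<^sup>u) x\<^sup>v h\<close>, and this is an element of \<open>I\<close> times an element of \<open>J\<close>; hence \<open>\<Phi>\<close>
  maps \<open>J\<close> into the product ideal. Any \<open>f\<close> in \<open>I \<inter> J\<close> therefore equals \<open>\<Phi> f\<close> and lies in the
  product ideal.
\<close>

lemma poly_mapping_eq_sum_single:
  fixes p :: "'a \<Rightarrow>\<^sub>0 'b::comm_monoid_add"
  shows "p = (\<Sum>m\<in>Poly_Mapping.keys p. Poly_Mapping.single m (Poly_Mapping.lookup p m))"
proof (rule poly_mapping_eqI)
  fix k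
  show "Poly_Mapping.lookup p k = Poly_Mapping.lookup
      (\<Sum>m\<in>Poly_Mapping.keys p. Poly_Mapping.single m (Poly_Mapping.lookup p m)) k"
    by (simp add: lookup_sum lookup_single when_def in_keys_iff)
qed

lemma poly_mapping_additive_induct [case_names zero add single]:
  fixes p :: "'a \<Rightarrow>\<^sub>0 'b::comm_monoid_add"
  assumes "P 0" and "\<And>a b. P a \<Longrightarrow> P b \<Longrightarrow> P (a + b)"
    and "\<And>m c. m \<in> Poly_Mapping.keys p \<Longrightarrow> P (Poly_Mapping.single m c)"
  shows "P p"
proof -
  have "P (\<Sum>m\<in>M. Poly_Mapping.single m (Poly_Mapping.lookup p m))"
    if "finite M" "M \<subseteq> Poly_Mapping.keys p" for M
    using that by (induction M) (auto intro: assms)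
  then show ?thesis
    using poly_mapping_eq_sum_single[of p] by (metis finite_keys order_refl)
qed

lemma vars_single: "vars (Poly_Mapping.single m c) \<subseteq> Poly_Mapping.keys m"
  by (auto simp: vars_def)

section \<open>Linear projections of the polynomial ring\<close>

text \<open>
  Scalars act through constant polynomials, which makes the polynomial ring over a field a vector
  space, so that every subspace has a complement.
\<close>

lemma linear_projection_onto:
  fixes V :: "'k::field mpoly set"
  assumes zero: "0 \<in> V" and add: "\<And>a b. a \<in> V \<Longrightarrow> b \<in> V \<Longrightarrow> a + b \<in> V"
    and scale: "\<And>c a. a \<in> V \<Longrightarrow> Poly_Mapping.single 0 c * a \<in> V"
  obtains \<phi> :: "'k mpoly \<Rightarrow> 'k mpoly"
  where "\<And>a b. \<phi> (a + b) = \<phi> a + \<phi> b"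
    and "\<And>c a. \<phi> (Poly_Mapping.single 0 c * a) = Poly_Mapping.single 0 c * \<phi> a"
    and "\<And>a. \<phi> a \<in> V" and "\<And>a. a \<in> V \<Longrightarrow> \<phi> a = a"
proof -
  define s :: "'k \<Rightarrow> 'k mpoly \<Rightarrow> 'k mpoly" where "s c a = Poly_Mapping.single 0 c * a" for c a
  have vs: "vector_space s"
    unfolding vector_space_def
    by (simp add: s_def distrib_left distrib_right single_add mult_single flip: mult.assoc)
  interpret vector_space_pair s s
    by (simp add: vector_space_pair_def vs)
  have "vs1.subspace V"
    unfolding vs1.subspace_def using assms by (simp add: s_def)
  moreover have "Vector_Spaces.linear s s (\<lambda>a. a)"
    by (rule vs1.linear_ident)
  ultimately obtain \<phi> where \<phi>: "range \<phi> \<subseteq> V" "Vector_Spaces.linear s s \<phi>" "\<forall>v\<in>V. \<phi> v = v"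
    using linear_exists_left_inverse_on[of "\<lambda>a. a" V] by auto
  show ?thesis
  proof
    show "\<phi> (a + b) = \<phi> a + \<phi> b" for a b
      by (rule linear_add[OF \<phi>(2)])
    show "\<phi> (Poly_Mapping.single 0 c * a) = Poly_Mapping.single 0 c * \<phi> a" for c a
      using linear_scale[OF \<phi>(2), of c a] by (simp add: s_def)
  qed (use \<phi> in auto)
qed

section \<open>Extending linear maps across separated variables\<close>

definition restrict_monom :: "nat set \<Rightarrow> monom \<Rightarrow> monom" where
  "restrict_monom X = Poly_Mapping.mapp (\<lambda>i e. e when i \<in> X)"

lemma lookup_restrict_monom:
  "Poly_Mapping.lookup (restrict_monom X m) i = (Poly_Mapping.lookup m i when i \<in> X)"
  by (simp add: restrict_monom_def lookup_mapp when_def in_keys_iff)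

lemma keys_restrict_monom: "Poly_Mapping.keys (restrict_monom X m) = Poly_Mapping.keys m \<inter> X"
  by (auto simp: in_keys_iff lookup_restrict_monom when_def split: if_splits)

lemma restrict_monom_split: "restrict_monom X m + restrict_monom (- X) m = m"
  by (rule poly_mapping_eqI) (simp add: lookup_add lookup_restrict_monom when_def)

lemma restrict_monom_add_left:
  assumes "Poly_Mapping.keys u \<subseteq> X" "Poly_Mapping.keys v \<subseteq> - X"
  shows "restrict_monom X (u + v) = u"
  by (rule poly_mapping_eqI)
    (use assms in \<open>auto simp: lookup_add lookup_restrict_monom when_def in_keys_iff\<close>)

lemma restrict_monom_add_right:
  assumes "Poly_Mapping.keys u \<subseteq> X" "Poly_Mapping.keys v \<subseteq> - X"
  shows "restrict_monom (- X) (u + v) = v"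
  using restrict_monom_add_left[of v "- X" u] assms by (simp add: add.commute)

text \<open>
  This is the map \<open>\<phi> \<otimes> id\<close> on \<open>k[X] \<otimes> k[-X]\<close>, followed by multiplication. It is given on the basis
  of monomials, each of which is a product of a monomial in \<open>X\<close> and one outside \<open>X\<close> in exactly
  one way.
\<close>

definition separated_extension ::
    "nat set \<Rightarrow> ('k::comm_ring_1 mpoly \<Rightarrow> 'k mpoly) \<Rightarrow> 'k mpoly \<Rightarrow> 'k mpoly" where
  "separated_extension X \<phi> f =
     (\<Sum>m\<in>Poly_Mapping.keys f. Poly_Mapping.single 0 (Poly_Mapping.lookup f m) *
        (\<phi> (Poly_Mapping.single (restrict_monom X m) 1) *
         Poly_Mapping.single (restrict_monom (- X) m) 1))"

lemma separated_extension_zero [simp]: "separated_extension X \<phi> 0 = 0"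
  by (simp add: separated_extension_def)

lemma separated_extension_add:
  "separated_extension X \<phi> (f + g) = separated_extension X \<phi> f + separated_extension X \<phi> g"
  unfolding separated_extension_def
  by (rule setsum_keys_plus_distrib) (simp_all add: single_add algebra_simps)

lemma separated_extension_single:
  "separated_extension X \<phi> (Poly_Mapping.single m c) = Poly_Mapping.single 0 c *
     (\<phi> (Poly_Mapping.single (restrict_monom X m) 1) *
      Poly_Mapping.single (restrict_monom (- X) m) 1)"
  by (cases "c = 0") (simp_all add: separated_extension_def)

text \<open>Both sides are bilinear in \<open>p\<close> and \<open>q\<close>, so it suffices to compare them on monomials.\<close>

lemma separated_extension_mult:
  fixes \<phi> :: "'k::comm_ring_1 mpoly \<Rightarrow> 'k mpoly"
  assumes add: "\<And>a b. \<phi> (a + b) = \<phi> a + \<phi> b"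
    and scale: "\<And>c a. \<phi> (Poly_Mapping.single 0 c * a) = Poly_Mapping.single 0 c * \<phi> a"
    and p: "vars p \<subseteq> X" and q: "vars q \<subseteq> - X"
  shows "separated_extension X \<phi> (p * q) = \<phi> p * q"
proof (induction p rule: poly_mapping_additive_induct)
  case zero
  show ?case using scale[of 0 0] by simp
next
  case (add a b)
  then show ?case by (simp add: assms(1) distrib_right separated_extension_add)
next
  case u: (single u c)
  show ?case
  proof (induction q rule: poly_mapping_additive_induct)
    case zero
    show ?case by simp
  next
    case (add a b)
    then show ?case by (simp add: distrib_left separated_extension_add)
  next
    case v: (single v d)
    have split: "restrict_monom X (u + v) = u" "restrict_monom (- X) (u + v) = v"
      using restrict_monom_add_left[of u X v] restrict_monom_add_right[of u X v] p q u v
      by (auto simp: vars_def)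
    have "\<phi> (Poly_Mapping.single u c) = Poly_Mapping.single 0 c * \<phi> (Poly_Mapping.single u 1)"
      using scale[of c "Poly_Mapping.single u 1"] by (simp add: mult_single)
    moreover have "Poly_Mapping.single v d = Poly_Mapping.single 0 d * Poly_Mapping.single v 1"
      by (simp add: mult_single)
    moreover have "Poly_Mapping.single 0 (c * d) =
        Poly_Mapping.single 0 c * (Poly_Mapping.single 0 d :: 'k mpoly)"
      by (simp add: mult_single)
    moreover have "Poly_Mapping.single u c * Poly_Mapping.single v d =
        Poly_Mapping.single (u + v) (c * d)"
      by (rule mult_single)
    ultimately show ?case
      by (simp only: separated_extension_single split mult.assoc mult.left_commute)
  qed
qed

section \<open>Generated ideals\<close>

lemma mpoly_ring_simps:
  "p \<in> carrier (mpoly_ring n) \<longleftrightarrow> vars p \<subseteq> {1..n}"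
  "p \<otimes>\<^bsub>mpoly_ring n\<^esub> q = p * q" "p \<oplus>\<^bsub>mpoly_ring n\<^esub> q = p + q"
  "\<zero>\<^bsub>mpoly_ring n\<^esub> = 0" "\<one>\<^bsub>mpoly_ring n\<^esub> = 1"
  by (simp_all add: mpoly_ring_def)

lemma a_inv_mpoly_ring:
  fixes p :: "'k::comm_ring_1 mpoly"
  assumes "p \<in> carrier (mpoly_ring n)"
  shows "\<ominus>\<^bsub>mpoly_ring n\<^esub> p = - p"
proof -
  interpret cring "mpoly_ring n :: 'k mpoly ring" by (rule cring_mpoly_ring)
  show ?thesis
    by (rule minus_equality) (use assms in \<open>simp_all add: mpoly_ring_simps\<close>)
qed

text \<open>
  A generated ideal is the additive span of the monomial multiples of its generators. The
  polynomials all of whose multiples satisfy \<open>P\<close> form an ideal, and that ideal contains the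
  generators because every multiplier is a sum of terms.
\<close>

lemma genideal_monomial_induct [consumes 2, case_names zero add mult]:
  fixes G :: "'k::comm_ring_1 mpoly set"
  assumes f: "f \<in> Idl\<^bsub>mpoly_ring n\<^esub> G" and G: "G \<subseteq> carrier (mpoly_ring n)"
    and zero: "P 0" and add: "\<And>a b. P a \<Longrightarrow> P b \<Longrightarrow> P (a + b)"
    and mult: "\<And>m c g. Poly_Mapping.keys m \<subseteq> {1..n} \<Longrightarrow> g \<in> G \<Longrightarrow>
      P (Poly_Mapping.single m c * g)"
  shows "P f"
proof -
  let ?R = "mpoly_ring n :: 'k mpoly ring"
  interpret cring ?R by (rule cring_mpoly_ring)
  define K where "K = {f \<in> carrier ?R. \<forall>q\<in>carrier ?R. P (q * f)}"
  have K_mult: "x * a \<in> K" if "a \<in> K" "x \<in> carrier ?R" for a x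
    using that m_closed[of x a] m_closed[of _ x]
    by (auto simp: K_def mpoly_ring_simps simp flip: mult.assoc)
  have "ideal K ?R"
  proof (rule idealI)
    show "subgroup K (add_monoid ?R)"
    proof (rule add.subgroupI)
      show "K \<noteq> {}"
        using zero zero_closed by (auto simp: K_def mpoly_ring_simps intro!: exI[of _ 0])
      show "\<ominus>\<^bsub>?R\<^esub> a \<in> K" if "a \<in> K" for a
        using K_mult[OF that, of "- 1"] that
        by (simp add: a_inv_mpoly_ring K_def mpoly_ring_simps)
      show "a \<oplus>\<^bsub>?R\<^esub> b \<in> K" if "a \<in> K" "b \<in> K" for a b
        using that a_closed[of a b] add by (simp add: K_def mpoly_ring_simps distrib_left)
    qed (auto simp: K_def)
  qed (use K_mult in \<open>auto simp: mpoly_ring_simps mult.commute ring_axioms\<close>)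
  moreover have "G \<subseteq> K"
  proof
    fix g assume g: "g \<in> G"
    have "P (q * g)" if "q \<in> carrier ?R" for q
    proof (induction q rule: poly_mapping_additive_induct)
      case (single m c)
      with that have "Poly_Mapping.keys m \<subseteq> {1..n}"
        by (auto simp: mpoly_ring_simps vars_def)
      then show ?case using g by (rule mult)
    qed (simp_all add: zero add distrib_right)
    then show "g \<in> K" using g G by (auto simp: K_def)
  qed
  ultimately have "f \<in> K"
    using f genideal_minimal by blast
  then have "P (1 * f)"
    unfolding K_def using one_closed by (simp only: mem_Collect_eq mpoly_ring_simps)
  then show ?thesis by simp
qed

section \<open>Intersection and product\<close>

theorem genideal_inter_eq_prod_of_separated_vars:
  fixes G H :: "'k::field mpoly set"
  assumes G: "G \<subseteq> carrier (mpoly_ring n)" and H: "H \<subseteq> carrier (mpoly_ring n)"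
    and separated: "Gens H \<inter> Gens G = {}"
  defines "I \<equiv> Idl\<^bsub>mpoly_ring n\<^esub> G" and "J \<equiv> Idl\<^bsub>mpoly_ring n\<^esub> H"
  shows "I \<inter> J = I \<cdot>\<^bsub>mpoly_ring n\<^esub> J"
proof -
  let ?R = "mpoly_ring n :: 'k mpoly ring"
  interpret cring ?R by (rule cring_mpoly_ring)
  interpret I: ideal I ?R unfolding I_def by (rule genideal_ideal[OF G])
  interpret J: ideal J ?R unfolding J_def by (rule genideal_ideal[OF H])
  interpret IJ: ideal "I \<cdot>\<^bsub>?R\<^esub> J" ?R
    by (rule ideal_prod_is_ideal[OF I.is_ideal J.is_ideal])
  have single_carrier: "Poly_Mapping.single m c \<in> carrier ?R"
    if "Poly_Mapping.keys m \<subseteq> {1..n}" for m and c :: 'k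
    using that vars_single[of m c] by (auto simp: mpoly_ring_simps)
  have I_mult: "q * a \<in> I" if "a \<in> I" "q \<in> carrier ?R" for q a
    using I.I_l_closed[OF that] by (simp add: mpoly_ring_simps)
  have J_mult: "q * a \<in> J" if "a \<in> J" "q \<in> carrier ?R" for q a
    using J.I_l_closed[OF that] by (simp add: mpoly_ring_simps)
  obtain \<phi> :: "'k mpoly \<Rightarrow> 'k mpoly"
    where \<phi>_add: "\<And>a b. \<phi> (a + b) = \<phi> a + \<phi> b"
      and \<phi>_scale: "\<And>c a. \<phi> (Poly_Mapping.single 0 c * a) = Poly_Mapping.single 0 c * \<phi> a"
      and \<phi>_in: "\<And>a. \<phi> a \<in> I" and \<phi>_id: "\<And>a. a \<in> I \<Longrightarrow> \<phi> a = a"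
  proof (rule linear_projection_onto[of I])
    show "0 \<in> I" using I.zero_closed by (simp add: mpoly_ring_simps)
    show "a + b \<in> I" if "a \<in> I" "b \<in> I" for a b
      using I.a_closed[OF that] by (simp add: mpoly_ring_simps)
    show "Poly_Mapping.single 0 c * a \<in> I" if "a \<in> I" for c a
      using I_mult[OF that single_carrier] by simp
  qed blast
  define X where "X = Gens G"
  define \<Phi> where "\<Phi> = separated_extension X \<phi>"
  have \<Phi>_mult: "\<Phi> (p * q) = \<phi> p * q" if "vars p \<subseteq> X" "vars q \<subseteq> - X" for p q
    unfolding \<Phi>_def by (rule separated_extension_mult) (fact \<phi>_add \<phi>_scale that)+
  have single_split: "Poly_Mapping.single m c =
      Poly_Mapping.single (restrict_monom X m) c *
      Poly_Mapping.single (restrict_monom (- X) m) (1::'k)" for m c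
    by (simp add: mult_single restrict_monom_split)
  have vars_X: "vars (Poly_Mapping.single (restrict_monom X m) c) \<subseteq> X" for m and c :: 'k
    using vars_single[of "restrict_monom X m" c] by (auto simp: keys_restrict_monom)
  have vars_nX: "vars (Poly_Mapping.single (restrict_monom (- X) m) c) \<subseteq> - X" for m and c :: 'k
    using vars_single[of "restrict_monom (- X) m" c] by (auto simp: keys_restrict_monom)
  have carrier: "Poly_Mapping.single (restrict_monom Y m) c \<in> carrier ?R"
    if "Poly_Mapping.keys m \<subseteq> {1..n}" for Y m and c :: 'k
    using that by (intro single_carrier) (auto simp: keys_restrict_monom)
  have fixes_I: "\<Phi> f = f" if "f \<in> I" for f
    using that[unfolded I_def] G
  proof (induction f rule: genideal_monomial_induct)
    case (mult m c g)
    let ?u = "Poly_Mapping.single (restrict_monom X m) c"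
    let ?v = "Poly_Mapping.single (restrict_monom (- X) m) (1::'k)"
    have "vars g \<subseteq> X" using mult by (auto simp: X_def Gens_def)
    then have "vars (?u * g) \<subseteq> X"
      using vars_X[of m c] vars_mult[of ?u g] by blast
    then have "\<Phi> ((?u * g) * ?v) = \<phi> (?u * g) * ?v"
      using vars_nX by (rule \<Phi>_mult)
    moreover have "g \<in> I"
      unfolding I_def using genideal_self[OF G] mult by blast
    then have "\<phi> (?u * g) = ?u * g"
      using mult by (intro \<phi>_id I_mult carrier)
    moreover have "Poly_Mapping.single m c * g = (?u * g) * ?v"
      unfolding single_split[of m c] by (simp only: ac_simps)
    ultimately show ?case by (simp only:)
  qed (simp_all add: \<Phi>_def separated_extension_add)
  have maps_J: "\<Phi> f \<in> I \<cdot>\<^bsub>?R\<^esub> J" if "f \<in> J" for f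
    using that[unfolded J_def] H
  proof (induction f rule: genideal_monomial_induct)
    case zero
    show ?case using IJ.zero_closed by (simp add: \<Phi>_def mpoly_ring_simps)
  next
    case (add a b)
    then show ?case
      using IJ.a_closed[of "\<Phi> a" "\<Phi> b"]
      by (simp add: \<Phi>_def separated_extension_add mpoly_ring_simps)
  next
    case (mult m c h)
    let ?u = "Poly_Mapping.single (restrict_monom X m) c"
    let ?v = "Poly_Mapping.single (restrict_monom (- X) m) (1::'k)"
    have "vars h \<subseteq> - X" using mult separated by (auto simp: X_def Gens_def)
    then have "vars (?v * h) \<subseteq> - X"
      using vars_nX[of m 1] vars_mult[of ?v h] by blast
    then have "\<Phi> (?u * (?v * h)) = \<phi> ?u * (?v * h)"
      using vars_X by (intro \<Phi>_mult)
    moreover have "h \<in> J"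
      unfolding J_def using genideal_self[OF H] mult by blast
    then have "?v * h \<in> J"
      using mult by (intro J_mult carrier)
    then have "\<phi> ?u * (?v * h) \<in> I \<cdot>\<^bsub>?R\<^esub> J"
      using ideal_prod.prod[OF \<phi>_in, of "?v * h" J ?R ?u] by (simp add: mpoly_ring_simps)
    moreover have "Poly_Mapping.single m c * h = ?u * (?v * h)"
      unfolding single_split[of m c] by (simp only: ac_simps)
    ultimately show ?case by (simp only:)
  qed
  have "I \<inter> J \<subseteq> I \<cdot>\<^bsub>?R\<^esub> J"
    using fixes_I maps_J by (metis IntD1 IntD2 subsetI)
  moreover have "I \<cdot>\<^bsub>?R\<^esub> J \<subseteq> I \<inter> J"
    by (rule ideal_prod_inter[OF I.is_ideal J.is_ideal])
  ultimately show ?thesis by blast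
qed

theorem corollary1p5:
  fixes n :: nat and I J G H :: "'k::field mpoly set"
  assumes "homogeneous_ideal n I" and "homogeneous_ideal n J"
    and "minimal_homogeneous_gens n G I" and "minimal_homogeneous_gens n H J"
    and "Gens H \<inter> Gens G = {}"
  shows "I \<inter> J = I \<cdot>\<^bsub>mpoly_ring n\<^esub> J"
  using genideal_inter_eq_prod_of_separated_vars[of G n H] assms
  by (simp add: minimal_homogeneous_gens_def)

end
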